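(* Let $(W,S)$ be a Coxeter system with $S$ finite and of rank $|S|\geq 3$. Let $W^+$ be the alternating subgroup of $W$. Then the center $Z(W^+)$ of $W^+$ is included in the center of $W$. In particular, if $(W,S)$ is infinite, irreducible and of rank at least three, then $Z(W^+)$ is trivial.
   Context: The alternating subgroup $W^+$ of a Coxeter group $W$ with Coxeter system $(W,S)$ is the index-two subgroup of elements $w$ whose length $\ell_S(w)$ with respect to $S$ is even. *)

theory Defs
  imports "HOL-Algebra.Multiplicative_Group" "HOL-Algebra.Generated_Groups"
begin

definition center :: "('a, 'b) monoid_scheme \<Rightarrow> 'a set" where
  "center G = {z \<in> carrier G. \<forall>x \<in> carrier G. z \<otimes>\<^bsub>G\<^esub> x = x \<otimes>\<^bsub>G\<^esub> z}"

section \<open>Group presentations\<close>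

text \<open>The letter \<open>(a, True)\<close> stands for the generator \<open>a\<close> and
  \<open>(a, False)\<close> for its formal inverse.\<close>

type_synonym 'a gword = "('a \<times> bool) list"

definition letter_val :: "('a, 'b) monoid_scheme \<Rightarrow> 'a \<times> bool \<Rightarrow> 'a" where
  "letter_val G x = (if snd x then fst x else inv\<^bsub>G\<^esub> (fst x))"

definition word_val :: "('a, 'b) monoid_scheme \<Rightarrow> 'a gword \<Rightarrow> 'a" where
  "word_val G w = foldr (\<otimes>\<^bsub>G\<^esub>) (map (letter_val G) w) \<one>\<^bsub>G\<^esub>"

inductive presentation_step :: "'a set \<Rightarrow> 'a gword set \<Rightarrow> 'a gword \<Rightarrow> 'a gword \<Rightarrow> bool"
  for S :: "'a set" and R :: "'a gword set" where
  cancel: "a \<in> S \<Longrightarrow> presentation_step S R (u @ [(a, b), (a, \<not> b)] @ v) (u @ v)"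
| relator: "r \<in> R \<Longrightarrow> presentation_step S R (u @ r @ v) (u @ v)"

text \<open>\<open>G = \<langle>S | R\<rangle>\<close>, where the generators are elements of \<open>G\<close>: they generate \<open>G\<close>, and a word
  is trivial in \<open>G\<close> iff it becomes empty by inserting and deleting relators and pairs
  \<open>a a\<^sup>-\<^sup>1\<close>, \<open>a\<^sup>-\<^sup>1 a\<close>, that is, iff it lies in the normal closure of \<open>R\<close> in the
  free group on \<open>S\<close>.\<close>

definition has_presentation :: "('a, 'b) monoid_scheme \<Rightarrow> 'a set \<Rightarrow> 'a gword set \<Rightarrow> bool" where
  "has_presentation G S R \<longleftrightarrow>
     S \<subseteq> carrier G \<and> generate G S = carrier G \<and>
     (\<forall>w. fst ` set w \<subseteq> S \<longrightarrow>
        (word_val G w = \<one>\<^bsub>G\<^esub> \<longleftrightarrow> equivclp (presentation_step S R) w []))"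

section \<open>Coxeter systems\<close>

text \<open>The entry \<open>m(s,t)\<close> of the Coxeter matrix is the order of \<open>s t\<close>; by the convention for
  \<^const>\<open>group.ord\<close>, the value \<open>0\<close> encodes \<open>m(s,t) = \<infinity>\<close>.\<close>

definition coxeter_matrix :: "('a, 'b) monoid_scheme \<Rightarrow> 'a \<Rightarrow> 'a \<Rightarrow> nat" where
  "coxeter_matrix W s t = group.ord W (s \<otimes>\<^bsub>W\<^esub> t)"

definition coxeter_relators :: "('a, 'b) monoid_scheme \<Rightarrow> 'a set \<Rightarrow> 'a gword set" where
  "coxeter_relators W S =
     {concat (replicate (coxeter_matrix W s t) [(s, True), (t, True)]) | s t.
        s \<in> S \<and> t \<in> S \<and> coxeter_matrix W s t \<noteq> 0}"

definition coxeter_system :: "('a, 'b) monoid_scheme \<Rightarrow> 'a set \<Rightarrow> bool" where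
  "coxeter_system W S \<longleftrightarrow>
     group W \<and> S \<subseteq> carrier W \<and> (\<forall>s \<in> S. group.ord W s = 2) \<and>
     has_presentation W S (coxeter_relators W S)"

definition coxeter_length :: "('a, 'b) monoid_scheme \<Rightarrow> 'a set \<Rightarrow> 'a \<Rightarrow> nat" where
  "coxeter_length W S w =
     (LEAST n. \<exists>ss. set ss \<subseteq> S \<and> length ss = n \<and> foldr (\<otimes>\<^bsub>W\<^esub>) ss \<one>\<^bsub>W\<^esub> = w)"

definition alternating_subgroup ::
    "('a, 'b) monoid_scheme \<Rightarrow> 'a set \<Rightarrow> ('a, 'b) monoid_scheme" where
  "alternating_subgroup W S = W\<lparr>carrier := {w \<in> carrier W. even (coxeter_length W S w)}\<rparr>"

definition coxeter_graph :: "('a, 'b) monoid_scheme \<Rightarrow> 'a set \<Rightarrow> ('a \<times> 'a) set" where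
  "coxeter_graph W S =
     {(s, t). s \<in> S \<and> t \<in> S \<and> s \<noteq> t \<and> (coxeter_matrix W s t \<ge> 3 \<or> coxeter_matrix W s t = 0)}"

text \<open>Irreducibility: the Coxeter graph is nonempty and connected.\<close>

definition coxeter_irreducible :: "('a, 'b) monoid_scheme \<Rightarrow> 'a set \<Rightarrow> bool" where
  "coxeter_irreducible W S \<longleftrightarrow> S \<noteq> {} \<and> (\<forall>s \<in> S. \<forall>t \<in> S. (s, t) \<in> (coxeter_graph W S)\<^sup>*)"

end

theory Submission
  imports Defs
begin

text \<open>
  The parity with which a reflection occurs in a word is unchanged by the Coxeter relations;
  this yields the exchange condition, from which all else follows.

  Let \<open>z\<close> be central in the alternating subgroup. Since \<open>z\<close> commutes with \<open>s t\<close>, the conjugate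
  \<open>z' = s z s = t z t\<close> does not depend on the generator. Suppose \<open>z' \<noteq> z\<close>. If both have the same
  length, then every generator is a descent of \<open>z\<close> on exactly one side. As the rank is at least
  three, some side, say the left, has two descents \<open>s\<close>, \<open>t\<close>, and \<open>t s z\<close> has length
  \<open>\<ell>(z) - 2\<close>, whereas \<open>z t s\<close> has length at least \<open>\<ell>(z)\<close>. Otherwise the longer one, say \<open>z\<close>,
  has all generators as descents on both sides, so it is the longest element and conjugation
  by it permutes \<open>S\<close> by some \<open>\<sigma>\<close>; then \<open>s \<sigma>(s)\<close> is independent of \<open>s\<close>, which forces rank two.

  The left descents of an element central in the whole group are closed under adjacency in the
  Coxeter graph. In the irreducible case a nontrivial central element therefore has all
  generators as descents, hence is longest, and the group is finite.
\<close>

section \<open>Involutive generators and products of words in them\<close>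

locale coxeter = group W for W :: "('a, 'b) monoid_scheme" (structure) +
  fixes S :: "'a set"
  assumes system: "coxeter_system W S"
begin

abbreviation word_prod :: "'a list \<Rightarrow> 'a" where
  "word_prod ss \<equiv> foldr (\<otimes>) ss \<one>"

abbreviation len :: "'a \<Rightarrow> nat" where
  "len \<equiv> coxeter_length W S"

declare foldr_append [simp del]

lemma S_carrier: "s \<in> S \<Longrightarrow> s \<in> carrier W"
  using system by (auto simp: coxeter_system_def)

lemma ord_S: "s \<in> S \<Longrightarrow> ord s = 2"
  using system by (auto simp: coxeter_system_def)

lemma S_square: "s \<in> S \<Longrightarrow> s \<otimes> s = \<one>"
  using pow_ord_eq_1[of s] by (simp add: S_carrier ord_S numeral_2_eq_2)

lemma S_not_one: "s \<in> S \<Longrightarrow> s \<noteq> \<one>"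
  using ord_S ord_id by fastforce

lemma inv_S: "s \<in> S \<Longrightarrow> inv s = s"
  by (simp add: S_carrier S_square inv_equality)

lemma S_cancel: "s \<in> S \<Longrightarrow> x \<in> carrier W \<Longrightarrow> s \<otimes> (s \<otimes> x) = x"
  by (simp add: S_carrier S_square flip: m_assoc)

lemma S_mult_eq_one: "s \<in> S \<Longrightarrow> t \<in> S \<Longrightarrow> s \<otimes> t = \<one> \<Longrightarrow> s = t"
  using S_carrier S_cancel r_one by metis

lemma word_prod_closed [simp]: "set ss \<subseteq> carrier W \<Longrightarrow> word_prod ss \<in> carrier W"
  by (induction ss) auto

lemma word_prod_closed_S [simp]: "set ss \<subseteq> S \<Longrightarrow> word_prod ss \<in> carrier W"
  using S_carrier by (intro word_prod_closed) auto

lemma word_prod_append: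
  "set us \<subseteq> carrier W \<Longrightarrow> set vs \<subseteq> carrier W \<Longrightarrow>
    word_prod (us @ vs) = word_prod us \<otimes> word_prod vs"
  by (induction us) (auto simp: m_assoc)

lemma word_prod_rev:
  assumes "set ss \<subseteq> S"
  shows "word_prod (rev ss) = inv (word_prod ss)"
  using assms
proof (induction ss)
  case (Cons s ss)
  have "set ss \<subseteq> carrier W" using Cons.prems S_carrier by auto
  then show ?case
    using Cons S_carrier by (simp add: word_prod_append inv_mult_group inv_S)
qed simp

lemma word_exists:
  assumes "w \<in> carrier W"
  obtains ss where "set ss \<subseteq> S" "word_prod ss = w"
proof -
  have gen: "w \<in> generate W S"
    using assms system by (auto simp: coxeter_system_def has_presentation_def)
  have "\<exists>ss. set ss \<subseteq> S \<and> word_prod ss = w"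
    using gen
  proof (induction rule: generate.induct)
    case one
    show ?case by (rule exI[of _ "[]"]) simp
  next
    case (incl h)
    then show ?case by (intro exI[of _ "[h]"]) (simp add: S_carrier)
  next
    case (inv h)
    then show ?case by (intro exI[of _ "[h]"]) (simp add: S_carrier inv_S)
  next
    case (eng h1 h2)
    then obtain us vs where "set us \<subseteq> S" "word_prod us = h1" "set vs \<subseteq> S" "word_prod vs = h2"
      by blast
    then show ?case
      using S_carrier by (intro exI[of _ "us @ vs"]) (simp add: word_prod_append subset_iff)
  qed
  then show thesis using that by blast
qed

section \<open>Reflection counts and the exchange condition\<close>

text \<open>The reflections \<open>s\<^sub>1 \<dots> s\<^sub>i \<dots> s\<^sub>1\<close> of a word \<open>s\<^sub>1 \<dots> s\<^sub>k\<close>.\<close>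

fun refls :: "'a list \<Rightarrow> 'a list" where
  "refls [] = []"
| "refls (s # ss) = s # map (\<lambda>t. s \<otimes> t \<otimes> inv s) (refls ss)"

lemma refls_closed: "set ss \<subseteq> carrier W \<Longrightarrow> set (refls ss) \<subseteq> carrier W"
  by (induction ss) auto

lemma count_conj:
  assumes "set ts \<subseteq> carrier W" "g \<in> carrier W" "t \<in> carrier W"
  shows "count_list (map (\<lambda>t. g \<otimes> t \<otimes> inv g) ts) t = count_list ts (inv g \<otimes> t \<otimes> g)"
proof -
  have "g \<otimes> r \<otimes> inv g = t \<longleftrightarrow> r = inv g \<otimes> t \<otimes> g" if "r \<in> carrier W" for r
    using that assms by (metis inv_closed inv_solve_left inv_solve_right m_assoc m_closed)
  then show ?thesis using assms(1) by (induction ts) auto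
qed

text \<open>A cocycle rule: the prefix \<open>us\<close> acts on the reflections of
  \<open>vs\<close> only through conjugation by its product. Hence an infix with product one leaves
  the contribution of what follows unchanged.\<close>

lemma count_refls_append:
  assumes "set us \<subseteq> carrier W" "set vs \<subseteq> carrier W" "t \<in> carrier W"
  shows "count_list (refls (us @ vs)) t =
    count_list (refls us) t + count_list (refls vs) (inv (word_prod us) \<otimes> t \<otimes> word_prod us)"
  using assms
proof (induction us arbitrary: t)
  case (Cons u us)
  define t' where "t' = inv u \<otimes> t \<otimes> u"
  have c: "u \<in> carrier W" "set us \<subseteq> carrier W" "t' \<in> carrier W"
    using Cons.prems by (auto simp: t'_def)
  have count: "count_list (refls (u # xs)) t = (if u = t then 1 else 0) + count_list (refls xs) t'"
    if "set xs \<subseteq> carrier W" for xs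
    using that c Cons.prems(3) by (simp add: count_conj refls_closed t'_def)
  have "inv (word_prod (u # us)) \<otimes> t \<otimes> word_prod (u # us) =
      inv (word_prod us) \<otimes> t' \<otimes> word_prod us"
    using c Cons.prems(3) by (simp add: t'_def inv_mult_group m_assoc)
  then show ?case
    using count[OF c(2)] count[of "us @ vs"] Cons.IH[OF c(2) Cons.prems(2) c(3)] c Cons.prems(2)
    by simp
qed simp

lemma refls_dihedral:
  assumes "s \<in> S" "t \<in> S"
  shows "refls (concat (replicate n [s, t])) = map (\<lambda>i. (s \<otimes> t) [^] i \<otimes> s) [0..<2 * n]"
proof (induction n)
  case (Suc n)
  let ?c = "s \<otimes> t"
  have c: "s \<in> carrier W" "t \<in> carrier W" using assms S_carrier by auto
  \<comment> \<open>Putting \<open>s t\<close> in front conjugates the old reflections by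
    \<open>s t\<close>, which raises the exponent by two.\<close>
  have shift: "s \<otimes> (t \<otimes> (?c [^] i \<otimes> s) \<otimes> t) \<otimes> s = ?c [^] Suc (Suc i) \<otimes> s" for i
  proof -
    have "?c [^] Suc (Suc i) = ?c \<otimes> ?c [^] i \<otimes> ?c"
      using c nat_pow_Suc2[of ?c "Suc i"] by (simp add: m_assoc)
    then show ?thesis using c by (simp only: m_assoc m_closed nat_pow_closed)
  qed
  have "[0..<2 * Suc n] = 0 # 1 # map (\<lambda>i. Suc (Suc i)) [0..<2 * n]"
    using map_add_upt[of 2 "2 * n"]
    by (simp add: upt_conv_Cons numeral_2_eq_2 del: upt_Suc)
  then show ?case
    using c Suc by (simp add: inv_S assms shift comp_def)
qed simp

text \<open>By \<open>refls_dihedral\<close> the reflections are indexed by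
  \<open>i < 2 * m\<close>, and \<open>(s t)^m = 1\<close> makes the list \<open>m\<close>-periodic.
  It is therefore a list written twice.\<close>

lemma count_refls_relator:
  assumes "r \<in> coxeter_relators W S"
  shows "even (count_list (refls (map fst r)) x)"
proof -
  obtain s t where st: "s \<in> S" "t \<in> S"
    and r: "r = concat (replicate (coxeter_matrix W s t) [(s, True), (t, True)])"
    using assms by (auto simp: coxeter_relators_def)
  let ?m = "coxeter_matrix W s t"
  let ?f = "\<lambda>i. (s \<otimes> t) [^] i \<otimes> s"
  have c: "s \<in> carrier W" "t \<in> carrier W" using st S_carrier by auto
  have "map fst r = concat (replicate ?m [s, t])"
    by (simp add: r map_concat)
  moreover have "?f (i + ?m) = ?f i" for i
    using c by (simp add: coxeter_matrix_def pow_ord_eq_1 flip: nat_pow_mult)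
  then have "map ?f [?m..<?m + ?m] = map ?f [0..<?m]"
    by (intro nth_equalityI) (simp_all add: add.commute)
  then have "map ?f [0..<2 * ?m] = map ?f [0..<?m] @ map ?f [0..<?m]"
    using upt_add_eq_append[of 0 ?m ?m] by (simp add: mult_2)
  ultimately show ?thesis by (simp add: refls_dihedral st)
qed

lemma relator_letters: "r \<in> coxeter_relators W S \<Longrightarrow> set (map fst r) \<subseteq> S"
  by (auto simp: coxeter_relators_def)

lemma even_length_relator: "r \<in> coxeter_relators W S \<Longrightarrow> even (length r)"
  by (auto simp: coxeter_relators_def length_concat sum_list_replicate)

lemma word_prod_relator:
  assumes "r \<in> coxeter_relators W S"
  shows "word_prod (map fst r) = \<one>"
proof -
  obtain s t where st: "s \<in> S" "t \<in> S"
    and r: "r = concat (replicate (coxeter_matrix W s t) [(s, True), (t, True)])"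
    using assms by (auto simp: coxeter_relators_def)
  have c: "s \<in> carrier W" "t \<in> carrier W" using st S_carrier by auto
  have "word_prod (concat (replicate n [s, t])) = (s \<otimes> t) [^] n" for n :: nat
  proof (induction n)
    case (Suc n)
    show ?case
      using c Suc nat_pow_Suc2[of "s \<otimes> t" n] by (simp add: m_assoc)
  qed simp
  then show ?thesis
    using c by (simp add: r map_concat coxeter_matrix_def pow_ord_eq_1)
qed

text \<open>Two uses of the cocycle rule; the form covers cancelling pairs and Coxeter relators
  alike.\<close>

lemma neutral_infix:
  assumes "set us \<subseteq> S" "set rs \<subseteq> S" "set vs \<subseteq> S" "x \<in> carrier W"
    and "word_prod rs = \<one>" "\<And>y. y \<in> carrier W \<Longrightarrow> even (count_list (refls rs) y)"
  shows "even (count_list (refls (us @ rs @ vs)) x) \<longleftrightarrow> even (count_list (refls (us @ vs)) x)"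
proof -
  have c: "set us \<subseteq> carrier W" "set rs \<subseteq> carrier W" "set vs \<subseteq> carrier W"
    using assms S_carrier by auto
  show ?thesis
    using assms(4-6) c by (simp add: count_refls_append)
qed

text \<open>\<open>map fst\<close> forgets formal inverses, harmless because generators are
  involutions. The equivalence on letters carries the side condition through steps taken in either
  direction.\<close>

lemma presentation_step_invariant:
  assumes "presentation_step S (coxeter_relators W S) p q"
  shows "(set (map fst p) \<subseteq> S \<longleftrightarrow> set (map fst q) \<subseteq> S) \<and>
    (even (length p) \<longleftrightarrow> even (length q)) \<and>
    (set (map fst q) \<subseteq> S \<longrightarrow> (\<forall>x\<in>carrier W.
      even (count_list (refls (map fst p)) x) \<longleftrightarrow> even (count_list (refls (map fst q)) x)))"
  using assms
proof cases
  case (cancel a u b v)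
  have "even (count_list (refls (map fst [(a, b), (a, \<not> b)])) y)" for y
    using cancel by (simp add: S_carrier inv_S S_square)
  moreover have "word_prod (map fst [(a, b), (a, \<not> b)]) = \<one>"
    using cancel by (simp add: S_carrier S_square)
  ultimately show ?thesis
    using neutral_infix[of "map fst u" "map fst [(a, b), (a, \<not> b)]" "map fst v"] cancel
    by simp
next
  case (relator r u v)
  then show ?thesis
    using neutral_infix[of "map fst u" "map fst r" "map fst v"] count_refls_relator
      word_prod_relator relator_letters even_length_relator
    by auto
qed

lemma presentation_invariant:
  assumes "equivclp (presentation_step S (coxeter_relators W S)) p q" "set (map fst p) \<subseteq> S"
  shows "set (map fst q) \<subseteq> S \<and> (even (length p) \<longleftrightarrow> even (length q)) \<and>
    (\<forall>x\<in>carrier W.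
      even (count_list (refls (map fst p)) x) \<longleftrightarrow> even (count_list (refls (map fst q)) x))"
  using assms
proof (induction rule: equivclp_induct)
  case (step y z)
  then show ?case
    using presentation_step_invariant[of y z] presentation_step_invariant[of z y] by blast
qed simp

text \<open>The presentation links the word to the empty one, where both the length and every
  reflection count are zero.\<close>

lemma trivial_word:
  assumes "set ss \<subseteq> S" "word_prod ss = \<one>"
  shows "even (length ss)" "x \<in> carrier W \<Longrightarrow> even (count_list (refls ss) x)"
proof -
  let ?p = "map (\<lambda>s. (s, True)) ss"
  have p: "map fst ?p = ss" by (simp add: comp_def)
  have "word_val W ?p = \<one>"
    using assms by (simp add: word_val_def letter_val_def comp_def)
  then have "equivclp (presentation_step S (coxeter_relators W S)) ?p []"
    using system assms(1) by (auto simp: coxeter_system_def has_presentation_def image_image)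
  from presentation_invariant[OF this] p assms(1)
  show "even (length ss)" "x \<in> carrier W \<Longrightarrow> even (count_list (refls ss) x)"
    by auto
qed

text \<open>Both \<open>us @ rev vs\<close> and \<open>vs @ rev vs\<close> are trivial words, and
  the common tail contributes equally to each because the prefixes have the same product.\<close>

lemma same_word_prod:
  assumes "set us \<subseteq> S" "set vs \<subseteq> S" "word_prod us = word_prod vs"
  shows "even (length us) \<longleftrightarrow> even (length vs)"
    and "x \<in> carrier W \<Longrightarrow>
      even (count_list (refls us) x) \<longleftrightarrow> even (count_list (refls vs) x)"
proof -
  have c: "set us \<subseteq> carrier W" "set vs \<subseteq> carrier W" "set (rev vs) \<subseteq> carrier W"
    using assms S_carrier by auto
  have triv: "word_prod (us @ rev vs) = \<one>" "word_prod (vs @ rev vs) = \<one>"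
    using c assms by (simp_all only: word_prod_append word_prod_rev) (simp_all add: assms(3) c)
  have sub: "set (us @ rev vs) \<subseteq> S" "set (vs @ rev vs) \<subseteq> S" using assms by auto
  show "even (length us) \<longleftrightarrow> even (length vs)"
    using trivial_word(1)[OF sub(1) triv(1)] by simp
  assume x: "x \<in> carrier W"
  show "even (count_list (refls us) x) \<longleftrightarrow> even (count_list (refls vs) x)"
    using trivial_word(2)[OF sub(1) triv(1) x] trivial_word(2)[OF sub(2) triv(2) x]
    by (simp only: count_refls_append c x assms(3)) auto
qed

section \<open>The length function\<close>

lemma len_le: "set ss \<subseteq> S \<Longrightarrow> len (word_prod ss) \<le> length ss"
  unfolding coxeter_length_def by (rule Least_le) blast

lemma reduced_word:
  assumes "w \<in> carrier W"
  obtains ss where "set ss \<subseteq> S" "word_prod ss = w" "length ss = len w"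
proof -
  have "\<exists>n ss. set ss \<subseteq> S \<and> length ss = n \<and> word_prod ss = w"
    using word_exists[OF assms] by metis
  from LeastI_ex[OF this] show thesis
    using that unfolding coxeter_length_def by blast
qed

lemma even_len: "set ss \<subseteq> S \<Longrightarrow> even (len (word_prod ss)) \<longleftrightarrow> even (length ss)"
proof -
  assume ss: "set ss \<subseteq> S"
  then have "word_prod ss \<in> carrier W" by simp
  then obtain us where "set us \<subseteq> S" "word_prod us = word_prod ss" "length us = len (word_prod ss)"
    by (rule reduced_word)
  then show ?thesis using same_word_prod(1) ss by metis
qed

lemma len_mult_le:
  assumes "x \<in> carrier W" "y \<in> carrier W"
  shows "len (x \<otimes> y) \<le> len x + len y"
proof -
  obtain us where us: "set us \<subseteq> S" "word_prod us = x" "length us = len x"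
    using reduced_word[OF assms(1)] by blast
  obtain vs where vs: "set vs \<subseteq> S" "word_prod vs = y" "length vs = len y"
    using reduced_word[OF assms(2)] by blast
  have "word_prod (us @ vs) = x \<otimes> y"
    using us vs S_carrier by (subst word_prod_append) auto
  then show ?thesis using len_le[of "us @ vs"] us vs by simp
qed

lemma len_one: "len \<one> = 0"
  using len_le[of "[]"] by simp

lemma len_eq_0: "w \<in> carrier W \<Longrightarrow> len w = 0 \<longleftrightarrow> w = \<one>"
  by (metis foldr_Nil id_apply len_one length_0_conv reduced_word)

lemma len_S: "s \<in> S \<Longrightarrow> len s = 1"
  using len_le[of "[s]"] len_eq_0[of s] S_carrier[of s] S_not_one[of s] by simp

lemma len_eq_1:
  assumes "w \<in> carrier W" "len w = 1"
  shows "w \<in> S"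
proof -
  obtain ss where ss: "set ss \<subseteq> S" "word_prod ss = w" "length ss = 1"
    using reduced_word assms by metis
  then obtain s where "ss = [s]" by (auto simp: length_Suc_conv)
  then show ?thesis using ss S_carrier by auto
qed

lemma len_inv:
  assumes "w \<in> carrier W"
  shows "len (inv w) = len w"
proof -
  have le: "len (inv x) \<le> len x" if x: "x \<in> carrier W" for x
  proof -
    obtain ss where ss: "set ss \<subseteq> S" "word_prod ss = x" "length ss = len x"
      using reduced_word[OF x] by blast
    have "len (word_prod (rev ss)) \<le> length (rev ss)"
      using ss(1) by (intro len_le) simp
    then show ?thesis by (simp only: word_prod_rev[OF ss(1)] ss length_rev)
  qed
  have "len (inv (inv w)) \<le> len (inv w)" using assms by (intro le inv_closed)
  then show ?thesis using le[OF assms] assms by simp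
qed

text \<open>Subadditivity bounds the change by one, and parity excludes equality.\<close>

lemma len_S_mult:
  assumes "s \<in> S" "w \<in> carrier W"
  shows "len (s \<otimes> w) = len w + 1 \<or> len w = len (s \<otimes> w) + 1"
proof -
  obtain ss where ss: "set ss \<subseteq> S" "word_prod ss = w" "length ss = len w"
    using reduced_word[OF assms(2)] by blast
  have "even (len (s \<otimes> w)) \<longleftrightarrow> odd (len w)"
    using even_len[of "s # ss"] ss assms by simp
  moreover have "len (s \<otimes> w) \<le> 1 + len w"
    using len_mult_le[of s w] assms by (simp add: S_carrier len_S)
  moreover have "len w \<le> 1 + len (s \<otimes> w)"
    using len_mult_le[of s "s \<otimes> w"] assms by (simp add: S_carrier len_S S_cancel)
  ultimately show ?thesis by presburger
qed

lemma len_mult_S: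
  assumes "s \<in> S" "w \<in> carrier W"
  shows "len (w \<otimes> s) = len w + 1 \<or> len w = len (w \<otimes> s) + 1"
proof -
  have s: "s \<in> carrier W" using assms S_carrier by simp
  then have "len (s \<otimes> inv w) = len (w \<otimes> s)"
    using len_inv[of "w \<otimes> s"] assms by (simp only: inv_mult_group inv_S m_closed)
  then show ?thesis
    using len_S_mult[of s "inv w"] len_inv[of w] assms by simp
qed

section \<open>Deletion and exchange\<close>

text \<open>The reflection \<open>s1 ... si ... s1\<close> cancels the first \<open>i\<close>
  letters of the word and puts back all of them but \<open>si\<close>.\<close>

lemma refl_delete:
  assumes "set ss \<subseteq> S" "x \<in> set (refls ss)"
  shows "\<exists>us s vs. ss = us @ s # vs \<and> x \<otimes> word_prod ss = word_prod (us @ vs)"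
  using assms
proof (induction ss arbitrary: x)
  case (Cons s ss)
  have "set ss \<subseteq> carrier W" using Cons.prems(1) S_carrier by auto
  then have c: "s \<in> carrier W" "word_prod ss \<in> carrier W" "set (refls ss) \<subseteq> carrier W"
    using Cons.prems(1) S_carrier refls_closed by simp_all
  show ?case
  proof (cases "x = s")
    case True
    then show ?thesis
      using Cons.prems(1) c by (intro exI[of _ "[]"]) (simp add: S_cancel)
  next
    case False
    then obtain y where y: "y \<in> set (refls ss)" "x = s \<otimes> y \<otimes> inv s"
      using Cons.prems(2) by auto
    then obtain us r vs where d: "ss = us @ r # vs" "y \<otimes> word_prod ss = word_prod (us @ vs)"
      using Cons.IH[OF _ y(1)] Cons.prems(1) by auto
    have "y \<in> carrier W" using y c by auto
    then have "x \<otimes> word_prod (s # ss) = s \<otimes> (y \<otimes> word_prod ss)"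
      using c y(2) by (simp add: m_assoc inv_solve_left')
    then show ?thesis using d by (intro exI[of _ "s # us"]) simp
  qed
qed simp

text \<open>If \<open>s\<close> has odd count among the reflections of \<open>ss\<close>, it is one
  of them and a letter can be deleted. Even count would make \<open>s\<close> a reflection of a
  reduced word of the shorter element, and a deletion there would contradict the length
  hypothesis.\<close>

lemma exchange:
  assumes "s \<in> S" "set ss \<subseteq> S" "len (s \<otimes> word_prod ss) < len (word_prod ss)"
  shows "\<exists>us r vs. ss = us @ r # vs \<and> s \<otimes> word_prod ss = word_prod (us @ vs)"
proof (cases "even (count_list (refls ss) s)")
  case False
  then show ?thesis
    using refl_delete[OF assms(2)] by (metis count_notin even_zero)
next
  case True
  have c: "s \<in> carrier W" "set ss \<subseteq> carrier W" using assms S_carrier by auto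
  then have cc: "s \<otimes> word_prod ss \<in> carrier W" by simp
  \<comment> \<open>The leading letter counts once; conjugation by \<open>s\<close> fixes
    \<open>s\<close>, so the rest contributes the even count of \<open>ss\<close>.\<close>
  have "odd (count_list (refls (s # ss)) s)"
    using True c assms(1) count_conj[of "refls ss" s s] by (simp add: refls_closed inv_S S_square)
  moreover obtain vs where vs: "set vs \<subseteq> S" "word_prod vs = s \<otimes> word_prod ss"
    "length vs = len (s \<otimes> word_prod ss)"
    using reduced_word[OF cc] by blast
  ultimately have "odd (count_list (refls vs) s)"
    using same_word_prod(2)[of "s # ss" vs s] assms c by simp
  then have "s \<in> set (refls vs)"
    by (metis count_notin even_zero)
  then obtain us r ws where d: "vs = us @ r # ws" "s \<otimes> word_prod vs = word_prod (us @ ws)"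
    using refl_delete[OF vs(1)] by blast
  have "s \<otimes> word_prod vs = word_prod ss"
    using vs(2) assms c by (simp add: S_cancel)
  then have "len (word_prod ss) \<le> length (us @ ws)"
    using d len_le[of "us @ ws"] vs(1) by auto
  then show ?thesis using assms(3) vs(3) d(1) by simp
qed

text \<open>The exchange condition without words: the deleted letter lies either in the word of
  \<open>x\<close> or in that of \<open>y\<close>. Their concatenation may fail to be reduced, which
  \<open>exchange\<close> permits.\<close>

lemma exchange_mult:
  assumes "len (s \<otimes> (x \<otimes> y)) < len (x \<otimes> y)" "s \<in> S" "x \<in> carrier W" "y \<in> carrier W"
  obtains "len (s \<otimes> x) < len x"
  | y' where "y' \<in> carrier W" "len y' < len y" "s \<otimes> (x \<otimes> y) = x \<otimes> y'"
proof -
  obtain as where as: "set as \<subseteq> S" "word_prod as = x" "length as = len x"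
    using reduced_word[OF assms(3)] by blast
  obtain bs where bs: "set bs \<subseteq> S" "word_prod bs = y" "length bs = len y"
    using reduced_word[OF assms(4)] by blast
  have c: "set as \<subseteq> carrier W" "set bs \<subseteq> carrier W" using as bs S_carrier by auto
  have prod: "word_prod (as @ bs) = x \<otimes> y"
    using as bs c by (simp only: word_prod_append)
  obtain us r vs where d: "as @ bs = us @ r # vs" "s \<otimes> (x \<otimes> y) = word_prod (us @ vs)"
    using exchange[of s "as @ bs"] assms as bs prod by auto
  have uv: "set us \<subseteq> S" "set vs \<subseteq> S" "set us \<subseteq> carrier W" "set vs \<subseteq> carrier W"
    using arg_cong[OF d(1), of set] as(1) bs(1) c by auto
  show thesis
  proof (cases "length us < length as")
    case True
    then obtain as2 where as2: "as = us @ r # as2" "vs = as2 @ bs"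
      using d(1) by (auto simp: append_eq_append_conv2 append_eq_Cons_conv)
    have c2: "set (us @ as2) \<subseteq> carrier W" using as2 c by auto
    have "s \<otimes> x \<otimes> y = word_prod (us @ as2) \<otimes> y"
      using d(2) as2(2) assms S_carrier word_prod_append[OF c2 c(2)] bs(2) by (simp add: m_assoc)
    then have "s \<otimes> x = word_prod (us @ as2)"
      using assms S_carrier c2 by simp
    then have "len (s \<otimes> x) \<le> length (us @ as2)"
      using len_le[of "us @ as2"] as2 as(1) by auto
    then show thesis using that(1) as(3) as2(1) by simp
  next
    case False
    then obtain bs1 where bs1: "us = as @ bs1" "bs = bs1 @ r # vs"
      using d(1) by (auto simp: append_eq_append_conv2 append_eq_Cons_conv)
    have c2: "set (bs1 @ vs) \<subseteq> S" "set (bs1 @ vs) \<subseteq> carrier W" using bs1 bs c by auto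
    have "s \<otimes> (x \<otimes> y) = x \<otimes> word_prod (bs1 @ vs)"
      using d(2) bs1(1) word_prod_append[OF c(1) c2(2)] as(2) by simp
    moreover have "len (word_prod (bs1 @ vs)) < len y"
      using len_le[OF c2(1)] bs(3) bs1(2) by simp
    ultimately show thesis using that(2) c2(2) word_prod_closed by blast
  qed
qed

section \<open>Consequences of the exchange condition\<close>

lemma len_distinct_pair:
  assumes "s \<in> S" "t \<in> S" "s \<noteq> t"
  shows "len (s \<otimes> t) = 2"
  using len_S_mult[of s t] len_eq_0[of "s \<otimes> t"] S_mult_eq_one[of s t] assms S_carrier
  by (auto simp: len_S)

text \<open>In the factorization \<open>x = s (s x)\<close> the descent \<open>t\<close> cannot
  delete the first \<open>s\<close>, since \<open>t s\<close> has length two. So it deletes a letter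
  of \<open>s x\<close>.\<close>

lemma two_descents:
  assumes "s \<in> S" "t \<in> S" "s \<noteq> t" "x \<in> carrier W"
    and "len (s \<otimes> x) < len x" "len (t \<otimes> x) < len x"
  shows "len (s \<otimes> (t \<otimes> x)) + 2 \<le> len x"
proof -
  have c: "s \<in> carrier W" "t \<in> carrier W" using assms S_carrier by auto
  have "len (t \<otimes> (s \<otimes> (s \<otimes> x))) < len (s \<otimes> (s \<otimes> x))"
    using assms by (simp add: S_cancel)
  then show ?thesis
  proof (rule exchange_mult)
    assume "len (t \<otimes> s) < len s"
    then show ?thesis using len_distinct_pair[of t s] assms by (simp add: len_S)
  next
    fix y assume y: "y \<in> carrier W" "len y < len (s \<otimes> x)" "t \<otimes> (s \<otimes> (s \<otimes> x)) = s \<otimes> y"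
    then have "s \<otimes> (t \<otimes> x) = y" using assms by (simp add: S_cancel)
    then show ?thesis using y assms by simp
  qed (use assms c in simp_all)
qed

text \<open>Exchange in \<open>t s\<close> cannot touch \<open>t\<close>, so it deletes the last
  \<open>s\<close>.\<close>

lemma short_conjugate:
  assumes "s \<in> S" "t \<in> S" "s \<noteq> t" "len (s \<otimes> (t \<otimes> s)) < 2"
  shows "s \<otimes> (t \<otimes> s) = t"
proof -
  have c: "s \<in> carrier W" "t \<in> carrier W" using assms S_carrier by auto
  have "len (s \<otimes> (t \<otimes> s)) < len (t \<otimes> s)"
    using assms len_distinct_pair by simp
  then show ?thesis
  proof (rule exchange_mult)
    assume "len (s \<otimes> t) < len t"
    then show ?thesis using len_distinct_pair[of s t] assms by (simp add: len_S)
  next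
    fix y assume y: "y \<in> carrier W" "len y < len s" "s \<otimes> (t \<otimes> s) = t \<otimes> y"
    then show ?thesis using len_eq_0[of y] assms c by (simp add: len_S)
  qed (use assms c in simp_all)
qed

text \<open>By \<open>two_descents\<close>, \<open>x = t s y\<close> with \<open>y\<close> at least
  two shorter. Exchange for \<open>s\<close> cannot delete in \<open>t s\<close>, as
  \<open>s t s\<close> would then equal \<open>t\<close> and the generators would commute; so it
  shortens \<open>y\<close>.\<close>

lemma braid_descents:
  assumes "s \<in> S" "t \<in> S" "s \<otimes> t \<noteq> t \<otimes> s" "x \<in> carrier W"
    and "len (s \<otimes> x) < len x" "len (t \<otimes> x) < len x"
  shows "len (s \<otimes> (t \<otimes> (s \<otimes> x))) + 3 \<le> len x"
proof -
  have c: "s \<in> carrier W" "t \<in> carrier W" using assms S_carrier by auto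
  have ne: "s \<noteq> t" using assms(3) by auto
  define y where "y = s \<otimes> (t \<otimes> x)"
  have y: "y \<in> carrier W" "x = (t \<otimes> s) \<otimes> y"
    using c assms by (auto simp: y_def m_assoc S_cancel)
  have "len y + 2 \<le> len x"
    using two_descents[of s t x] assms ne by (simp add: y_def)
  have "len (s \<otimes> ((t \<otimes> s) \<otimes> y)) < len ((t \<otimes> s) \<otimes> y)"
    using assms y by simp
  then show ?thesis
  proof (rule exchange_mult)
    assume "len (s \<otimes> (t \<otimes> s)) < len (t \<otimes> s)"
    then have "s \<otimes> (t \<otimes> s) = t"
      using short_conjugate len_distinct_pair assms ne by metis
    then have "s \<otimes> t = t \<otimes> s"
      using S_cancel[of s "t \<otimes> s"] assms c by simp
    then show ?thesis using assms(3) by simp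
  next
    fix y' assume y': "y' \<in> carrier W" "len y' < len y" "s \<otimes> (t \<otimes> s \<otimes> y) = t \<otimes> s \<otimes> y'"
    then have "s \<otimes> (t \<otimes> (s \<otimes> x)) = y'"
      using y assms c by (simp add: m_assoc S_cancel)
    then show ?thesis using y'(2) \<open>len y + 2 \<le> len x\<close> by simp
  qed (use assms c y in simp_all)
qed

text \<open>Exchange in the product of \<open>x\<close> and \<open>s\<close> cannot delete inside
  \<open>x\<close>, where \<open>s\<close> is a left ascent; only the final \<open>s\<close>
  remains.\<close>

lemma conjugate_eq_of_ascents:
  assumes "s \<in> S" "x \<in> carrier W" "len (s \<otimes> x) > len x" "len (x \<otimes> s) > len x"
    and "len (s \<otimes> (x \<otimes> s)) \<le> len x"
  shows "s \<otimes> (x \<otimes> s) = x"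
proof -
  have c: "s \<in> carrier W" using assms S_carrier by auto
  have "len (s \<otimes> (x \<otimes> s)) < len (x \<otimes> s)" using assms by simp
  then show ?thesis
  proof (rule exchange_mult)
    fix y assume y: "y \<in> carrier W" "len y < len s" "s \<otimes> (x \<otimes> s) = x \<otimes> y"
    then show ?thesis using len_eq_0[of y] assms c by (simp add: len_S)
  qed (use assms c in simp_all)
qed

text \<open>Every \<open>w\<close> is the beginning of a reduced word of \<open>z\<close>, so \<open>z\<close> is the longest element.\<close>

lemma longest_prefix:
  assumes z: "z \<in> carrier W" "\<And>s. s \<in> S \<Longrightarrow> len (s \<otimes> z) < len z"
    and "w \<in> carrier W"
  shows "len (inv w \<otimes> z) + len w \<le> len z"
proof -
  have main: "len (inv (word_prod ss) \<otimes> z) + length ss \<le> len z"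
    if "set ss \<subseteq> S" "length ss = len (word_prod ss)" for ss
    using that
  proof (induction ss)
    case Nil
    then show ?case using z by simp
  next
    case (Cons s ss)
    define w where "w = word_prod ss"
    have c: "s \<in> S" "s \<in> carrier W" "w \<in> carrier W" "set ss \<subseteq> S"
      using Cons.prems(1) S_carrier by (auto simp: w_def)
    have red: "length ss = len w" "len (s \<otimes> w) = len w + 1"
      using Cons.prems(2) len_le[OF c(4)] len_S_mult[OF c(1,3)] by (auto simp: w_def)
    define v where "v = inv w \<otimes> z"
    have v: "v \<in> carrier W" "w \<otimes> v = z"
      using c z by (simp_all add: v_def flip: m_assoc)
    have IH: "len v + len w \<le> len z"
      using Cons.IH c red by (simp add: w_def v_def)
    \<comment> \<open>The word \<open>s # ss\<close> is reduced, so \<open>s\<close> is an ascent of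
      \<open>w\<close> and exchange must shorten the complement \<open>v\<close>.\<close>
    have "len (s \<otimes> (w \<otimes> v)) < len (w \<otimes> v)" using v z c by simp
    then show ?case
    proof (rule exchange_mult)
      fix y assume y: "y \<in> carrier W" "len y < len v" "s \<otimes> (w \<otimes> v) = w \<otimes> y"
      then have "y = inv w \<otimes> (s \<otimes> z)"
        using c z v by (simp add: inv_solve_left)
      also have "\<dots> = inv (word_prod (s # ss)) \<otimes> z"
        using c z by (simp add: inv_mult_group inv_S m_assoc flip: w_def)
      finally show ?thesis using IH y(2) red(1) by simp
    qed (use c v red in simp_all)
  qed
  obtain ss where "set ss \<subseteq> S" "word_prod ss = w" "length ss = len w"
    using reduced_word[OF assms(3)] by blast
  then show ?thesis using main[of ss] by simp
qed

lemma finite_if_longest: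
  assumes "finite S" "z \<in> carrier W" "\<And>s. s \<in> S \<Longrightarrow> len (s \<otimes> z) < len z"
  shows "finite (carrier W)"
proof -
  have "carrier W \<subseteq> word_prod ` {ss. set ss \<subseteq> S \<and> length ss \<le> len z}"
  proof
    fix w assume w: "w \<in> carrier W"
    obtain ss where ss: "set ss \<subseteq> S" "word_prod ss = w" "length ss = len w"
      using reduced_word[OF w] by blast
    then have "length ss \<le> len z"
      using longest_prefix[OF assms(2,3) w] by simp
    then show "w \<in> word_prod ` {ss. set ss \<subseteq> S \<and> length ss \<le> len z}"
      using ss by blast
  qed
  then show ?thesis
    using finite_lists_length_le[OF assms(1)] finite_surj by blast
qed

section \<open>Elements commuting with the products of two generators\<close>

text \<open>What centrality in the alternating subgroup gives for products of two generators. It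
  passes to inverses and to conjugates by a generator, so the argument can switch between these
  elements.\<close>

definition pair_central :: "'a \<Rightarrow> bool" where
  "pair_central z \<longleftrightarrow> z \<in> carrier W \<and> (\<forall>s\<in>S. \<forall>t\<in>S. s \<otimes> t \<otimes> z = z \<otimes> (s \<otimes> t))"

lemma pair_centralD:
  assumes "pair_central z" "s \<in> S" "t \<in> S"
  shows "z \<in> carrier W" "s \<otimes> (t \<otimes> z) = z \<otimes> (s \<otimes> t)"
  using assms S_carrier by (auto simp: pair_central_def m_assoc)

lemma pair_central_inv:
  assumes "pair_central z"
  shows "pair_central (inv z)"
  unfolding pair_central_def
proof (intro conjI ballI)
  show "inv z \<in> carrier W" using assms by (simp add: pair_central_def)
  fix s t assume "s \<in> S" "t \<in> S"
  then have "s \<otimes> t \<in> carrier W" "z \<in> carrier W" "s \<otimes> t \<otimes> z = z \<otimes> (s \<otimes> t)"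
    using assms S_carrier by (auto simp: pair_central_def)
  then show "s \<otimes> t \<otimes> inv z = inv z \<otimes> (s \<otimes> t)"
    by (metis inv_closed inv_solve_left inv_solve_right m_assoc m_closed)
qed

text \<open>Insert \<open>s s = 1\<close> in front of \<open>t z t\<close> and move
  \<open>s t\<close> across \<open>z\<close>.\<close>

lemma pair_central_conj_eq:
  assumes "pair_central z" "s \<in> S" "t \<in> S"
  shows "s \<otimes> (z \<otimes> s) = t \<otimes> (z \<otimes> t)"
proof -
  note z = pair_centralD[OF assms]
  have c: "s \<in> carrier W" "t \<in> carrier W" using assms S_carrier by auto
  have "t \<otimes> (z \<otimes> t) = s \<otimes> (s \<otimes> (t \<otimes> z)) \<otimes> t"
    using assms c z(1) by (simp add: S_cancel m_assoc)
  also have "\<dots> = s \<otimes> (z \<otimes> s)"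
    using assms c z(1) by (simp add: z(2) m_assoc S_square)
  finally show ?thesis ..
qed

text \<open>By independence of the generator the conjugate may be written with \<open>t\<close>,
  then with \<open>s\<close>, and finally with \<open>r\<close> again.\<close>

lemma pair_central_conj:
  assumes "pair_central z" "r \<in> S"
  shows "pair_central (r \<otimes> (z \<otimes> r))"
  unfolding pair_central_def
proof (intro conjI ballI)
  have z: "z \<in> carrier W" "r \<in> carrier W" using assms S_carrier by (auto simp: pair_central_def)
  then show "r \<otimes> (z \<otimes> r) \<in> carrier W" by simp
  fix s t assume st: "s \<in> S" "t \<in> S"
  have c: "s \<in> carrier W" "t \<in> carrier W" using st S_carrier by auto
  have "s \<otimes> t \<otimes> (r \<otimes> (z \<otimes> r)) = s \<otimes> t \<otimes> (t \<otimes> (z \<otimes> t))"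
    using pair_central_conj_eq assms st by metis
  also have "\<dots> = s \<otimes> (z \<otimes> s) \<otimes> (s \<otimes> t)"
    using c z st by (simp add: m_assoc S_cancel)
  also have "s \<otimes> (z \<otimes> s) = r \<otimes> (z \<otimes> r)"
    using pair_central_conj_eq assms st by metis
  finally show "s \<otimes> t \<otimes> (r \<otimes> (z \<otimes> r)) = r \<otimes> (z \<otimes> r) \<otimes> (s \<otimes> t)" .
qed

text \<open>Here \<open>z t s = t s z\<close> lies at least two below \<open>z\<close>, and removing
  the final \<open>s\<close> changes the length by only one.\<close>

lemma pair_central_two_left_descents:
  assumes "pair_central z" "s \<in> S" "t \<in> S" "s \<noteq> t"
    and "len (s \<otimes> z) < len z" "len (t \<otimes> z) < len z"
  shows "len (z \<otimes> t) < len z"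
proof -
  have c: "z \<in> carrier W" "t \<in> carrier W" "s \<in> carrier W"
    using assms S_carrier by (auto simp: pair_central_def)
  have "len (z \<otimes> t \<otimes> s) + 2 \<le> len z"
    using two_descents[of t s z] assms c pair_centralD(2)[of z t s] by (simp add: m_assoc)
  then show ?thesis
    using len_mult_S[of s "z \<otimes> t"] assms c by auto
qed

lemma left_xor_right_descent:
  assumes "z \<in> carrier W" "s \<in> S" "s \<otimes> (z \<otimes> s) \<noteq> z" "len (s \<otimes> (z \<otimes> s)) = len z"
  shows "len (s \<otimes> z) < len z \<longleftrightarrow> \<not> len (z \<otimes> s) < len z"
proof -
  have c: "s \<in> carrier W" using assms S_carrier by auto
  have False if "len (s \<otimes> z) > len z" "len (z \<otimes> s) > len z"
    using conjugate_eq_of_ascents[of s z] that assms by simp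
  moreover have False if d: "len (s \<otimes> z) < len z" "len (z \<otimes> s) < len z"
  proof -
    have "len (s \<otimes> z) = len (z \<otimes> s)"
      using d len_S_mult[of s z] len_mult_S[of s z] assms by auto
    moreover have eqs: "s \<otimes> (s \<otimes> z) = z" "s \<otimes> z \<otimes> s = s \<otimes> (z \<otimes> s)"
      "s \<otimes> (s \<otimes> z \<otimes> s) = z \<otimes> s"
      using assms(1,2) c by (simp_all add: S_cancel m_assoc)
    \<comment> \<open>Relative to \<open>s z\<close> both sides are ascents, so the ascent case
      applies to \<open>s z\<close> in place of \<open>z\<close>.\<close>
    ultimately have "s \<otimes> (s \<otimes> z \<otimes> s) = s \<otimes> z"
      using assms(1,2,4) c d(1) by (intro conjugate_eq_of_ascents) (simp_all only: m_closed)
    then have "s \<otimes> (z \<otimes> s) = z" using eqs by simp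
    then show False using assms(3) by simp
  qed
  ultimately show ?thesis
    using len_S_mult[of s z] len_mult_S[of s z] assms by fastforce
qed

lemma pair_central_equal_length:
  assumes z: "pair_central z" and card: "card S \<ge> 3"
    and conj: "\<And>s. s \<in> S \<Longrightarrow> s \<otimes> (z \<otimes> s) \<noteq> z \<and> len (s \<otimes> (z \<otimes> s)) = len z"
  shows False
proof -
  have c: "z \<in> carrier W" using z by (simp add: pair_central_def)
  define D where "D = {s \<in> S. len (s \<otimes> z) < len z}"
  have xor: "len (s \<otimes> z) < len z \<longleftrightarrow> \<not> len (z \<otimes> s) < len z" if "s \<in> S" for s
    using left_xor_right_descent[OF c that] conj[OF that] by simp
  have fin: "finite S" using card by (metis card.infinite not_numeral_le_zero)
  then have "card S = card D + card (S - D)"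
    by (metis (no_types, lifting) D_def card_Diff_subset card_mono finite_subset le_add_diff_inverse
        mem_Collect_eq subsetI)
  \<comment> \<open>Pigeonhole: two of at least three generators are descents on the same
    side.\<close>
  then consider "card D \<ge> 2" | "card (S - D) \<ge> 2" using card by linarith
  then show False
  proof cases
    case 1
    then obtain T where "T \<subseteq> D" "card T = 2" using obtain_subset_with_card_n by metis
    then obtain s t where "s \<in> D" "t \<in> D" "s \<noteq> t" by (auto simp: card_2_iff)
    then show False
      using pair_central_two_left_descents[OF z, of s t] xor by (auto simp: D_def)
  next
    case 2
    then obtain T where "T \<subseteq> S - D" "card T = 2" using obtain_subset_with_card_n by metis
    then obtain s t where st: "s \<in> S - D" "t \<in> S - D" "s \<noteq> t" by (auto simp: card_2_iff)
    \<comment> \<open>Inversion exchanges the sides, turning right descents of \<open>z\<close> into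
      left descents of \<open>inv z\<close>.\<close>
    have flip: "len (r \<otimes> inv z) = len (z \<otimes> r)" "len (inv z \<otimes> r) = len (r \<otimes> z)"
      if "r \<in> S" for r
      using that c S_carrier len_inv[of "z \<otimes> r"] len_inv[of "r \<otimes> z"]
      by (simp_all add: inv_mult_group inv_S)
    show False
      using pair_central_two_left_descents[OF pair_central_inv[OF z], of s t] st xor c
      by (auto simp: D_def flip len_inv)
  qed
qed

lemma pair_central_shorter_conj:
  assumes z: "pair_central z" and card: "card S \<ge> 3"
    and conj: "\<And>s. s \<in> S \<Longrightarrow> len (s \<otimes> (z \<otimes> s)) + 2 = len z"
  shows False
proof -
  have c: "z \<in> carrier W" using z by (simp add: pair_central_def)
  have desc: "len (s \<otimes> z) < len z" "len (z \<otimes> s) + 1 = len z" if "s \<in> S" for s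
  proof -
    have cs: "s \<in> carrier W" using that S_carrier by simp
    show "len (s \<otimes> z) < len z"
      using conj[OF that] len_mult_S[of s "s \<otimes> z"] that c cs by (auto simp: m_assoc)
    show "len (z \<otimes> s) + 1 = len z"
      using conj[OF that] len_S_mult[of s "z \<otimes> s"] len_mult_S[of s z] that c cs by auto
  qed
  define \<sigma> where "\<sigma> s = z \<otimes> s \<otimes> inv z" for s
  have \<sigma>: "\<sigma> s \<in> S" if s: "s \<in> S" for s
  proof -
    have cs: "s \<in> carrier W" "\<sigma> s \<in> carrier W" using s S_carrier c by (auto simp: \<sigma>_def)
    have zs: "inv (\<sigma> s) \<otimes> z = z \<otimes> s"
      using cs c s by (simp add: \<sigma>_def inv_mult_group inv_S m_assoc)
    \<comment> \<open>Since \<open>z\<close> is longest, \<open>\<sigma> s\<close> begins a reduced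
      word of \<open>z\<close>; its complement \<open>z s\<close> is only one shorter than
      \<open>z\<close>.\<close>
    then have "len (\<sigma> s) \<le> 1"
      using longest_prefix[OF c desc(1) cs(2)] desc(2)[OF s] by simp
    moreover have "\<sigma> s \<noteq> \<one>"
      using zs desc(2)[OF s] c by auto
    ultimately show ?thesis
      using len_eq_1[OF cs(2)] len_eq_0[OF cs(2)] by (cases "len (\<sigma> s)") auto
  qed
  have const: "s \<otimes> \<sigma> s = t \<otimes> \<sigma> t" if st: "s \<in> S" "t \<in> S" for s t
  proof -
    have "s \<otimes> \<sigma> s = s \<otimes> (z \<otimes> s) \<otimes> inv z" "t \<otimes> \<sigma> t = t \<otimes> (z \<otimes> t) \<otimes> inv z"
      using st S_carrier c by (simp_all add: \<sigma>_def m_assoc)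
    then show ?thesis using pair_central_conj_eq[OF z st] by simp
  qed
  have "S \<noteq> {}" using card by auto
  then obtain s where s: "s \<in> S" by auto
  define t where "t = \<sigma> s"
  have t: "t \<in> S" using \<sigma> s by (simp add: t_def)
  have cst: "s \<in> carrier W" "t \<in> carrier W" using s t S_carrier by auto
  have "s \<noteq> t"
  proof
    assume "s = t"
    then have "s \<otimes> z = z \<otimes> s"
      using cst c by (metis \<sigma>_def inv_solve_right m_closed t_def)
    then have "s \<otimes> (z \<otimes> s) = z" using s c by (metis S_cancel)
    then show False using conj[OF s] by simp
  qed
  have "card {s, t} \<le> 2" by (simp add: card_insert_if)
  then have "\<not> S \<subseteq> {s, t}"
    using card card_mono[of "{s, t}" S] by fastforce
  then obtain p where p: "p \<in> S" "p \<noteq> s" "p \<noteq> t" by auto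
  have cp: "p \<in> carrier W" using p S_carrier by auto
  \<comment> \<open>By \<open>const\<close>, \<open>s t = p \<sigma>(p)\<close>, so a third
    generator \<open>p\<close> cancels and leaves a single generator.\<close>
  have pst: "p \<otimes> (s \<otimes> t) = \<sigma> p"
    using const[OF s p(1)] p(1) \<sigma>[OF p(1)] S_carrier by (simp add: S_cancel t_def)
  have "len (p \<otimes> (s \<otimes> t)) < len (s \<otimes> t)"
    using len_distinct_pair[OF s t \<open>s \<noteq> t\<close>] \<sigma>[OF p(1)] by (simp add: pst len_S)
  \<comment> \<open>Exchange can only delete \<open>t\<close>, giving \<open>s t = p s\<close>. Then
    \<open>s t s = p\<close> has length one, which forces it to be \<open>t\<close>, contrary to the
    choice of \<open>p\<close>.\<close>
  then show False
  proof (rule exchange_mult)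
    assume "len (p \<otimes> s) < len s"
    then show False using len_distinct_pair[of p s] p s by (simp add: len_S)
  next
    fix y assume y: "y \<in> carrier W" "len y < len t" "p \<otimes> (s \<otimes> t) = s \<otimes> y"
    then have "p \<otimes> (s \<otimes> t) = s" using t cst by (simp add: len_S len_eq_0)
    then have "s \<otimes> t = p \<otimes> s" using S_cancel[of p "s \<otimes> t"] p cst by simp
    then have "s \<otimes> (t \<otimes> s) = p"
      using p s cst cp by (simp add: S_square m_assoc flip: m_assoc[of s t s])
    then show False
      using short_conjugate[of s t] s t \<open>s \<noteq> t\<close> p len_S by simp
  qed (use p s cst in simp_all)
qed

text \<open>The elements \<open>z\<close> and \<open>z'\<close> are conjugate to each other by every
  generator, so the unequal-length case applies to whichever is longer.\<close>

lemma pair_central_commutes: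
  assumes z: "pair_central z" and card: "card S \<ge> 3" and s: "s \<in> S"
  shows "z \<otimes> s = s \<otimes> z"
proof (rule ccontr)
  assume ne: "z \<otimes> s \<noteq> s \<otimes> z"
  have c: "z \<in> carrier W" "s \<in> carrier W" using z s S_carrier by (auto simp: pair_central_def)
  define z' where "z' = s \<otimes> (z \<otimes> s)"
  have z': "z' \<in> carrier W" "pair_central z'"
    using c pair_central_conj[OF z s] by (simp_all add: z'_def)
  have z's: "s \<otimes> (z' \<otimes> s) = z"
    using c s by (simp add: z'_def m_assoc S_cancel S_square)
  have "z' \<noteq> z" using ne S_cancel[OF s, of "z \<otimes> s"] c by (auto simp: z'_def)
  have conj: "t \<otimes> (z \<otimes> t) = z'" "t \<otimes> (z' \<otimes> t) = z" if "t \<in> S" for t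
    using pair_central_conj_eq[OF z s that] pair_central_conj_eq[OF z'(2) s that] z's
    by (simp_all add: z'_def)
  have "len z' = len z \<or> len z' + 2 = len z \<or> len z + 2 = len z'"
    using len_S_mult[of s "z \<otimes> s"] len_mult_S[of s z] s c by (auto simp: z'_def)
  then show False
    using pair_central_equal_length[OF z card] pair_central_shorter_conj[OF z card]
      pair_central_shorter_conj[OF z'(2) card] conj \<open>z' \<noteq> z\<close> by auto
qed

lemma commutes_generators_imp_center:
  assumes "z \<in> carrier W" "\<And>s. s \<in> S \<Longrightarrow> z \<otimes> s = s \<otimes> z"
  shows "z \<in> center W"
proof -
  have "z \<otimes> word_prod ss = word_prod ss \<otimes> z" if "set ss \<subseteq> S" for ss
    using that
  proof (induction ss)
    case (Cons s ss)
    then have c: "s \<in> carrier W" "word_prod ss \<in> carrier W" using S_carrier by auto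
    have "z \<otimes> (s \<otimes> word_prod ss) = s \<otimes> (z \<otimes> word_prod ss)"
      using assms Cons.prems c by (simp flip: m_assoc)
    then show ?case using Cons c assms(1) by (simp add: m_assoc)
  qed (use assms in simp)
  then show ?thesis
    unfolding center_def using assms(1) word_exists by blast
qed

lemma center_alternating_subset:
  assumes "card S \<ge> 3"
  shows "center (alternating_subgroup W S) \<subseteq> center W"
proof
  fix z assume z: "z \<in> center (alternating_subgroup W S)"
  have "even (len (s \<otimes> t))" if "s \<in> S" "t \<in> S" for s t
    using even_len[of "[s, t]"] that S_carrier by simp
  then have "pair_central z"
    using z S_carrier by (auto simp: center_def alternating_subgroup_def pair_central_def)
  then show "z \<in> center W"
    using pair_central_commutes assms commutes_generators_imp_center
    by (auto simp: pair_central_def)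
qed

section \<open>The center of an infinite irreducible Coxeter group\<close>

text \<open>A product of commuting involutions squares to one, while an edge has order at least
  three or the value \<open>0\<close> for infinite order.\<close>

lemma coxeter_graph_not_commute:
  assumes "(s, t) \<in> coxeter_graph W S"
  shows "s \<otimes> t \<noteq> t \<otimes> s"
proof
  assume comm: "s \<otimes> t = t \<otimes> s"
  have st: "s \<in> S" "t \<in> S" and m: "ord (s \<otimes> t) \<ge> 3 \<or> ord (s \<otimes> t) = 0"
    using assms by (auto simp: coxeter_graph_def coxeter_matrix_def)
  have c: "s \<in> carrier W" "t \<in> carrier W" using st S_carrier by auto
  have "(s \<otimes> t) [^] (2::nat) = (s \<otimes> t) \<otimes> (t \<otimes> s)"
    using c comm by (simp add: numeral_2_eq_2)
  also have "\<dots> = \<one>"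
    using c st by (simp add: m_assoc S_cancel S_square)
  finally have "(s \<otimes> t) [^] (2::nat) = \<one>" .
  then have "ord (s \<otimes> t) dvd 2" using pow_eq_id c by simp
  then show False using m dvd_imp_le[of "ord (s \<otimes> t)" 2] by auto
qed

text \<open>If \<open>t\<close> were an ascent, both \<open>s\<close> and \<open>t\<close> would be
  left descents of \<open>t z\<close>, and \<open>braid_descents\<close> would put
  \<open>t s z\<close> at least two below \<open>z\<close>. By centrality it equals
  \<open>(t z) s\<close>, of length at least that of \<open>z\<close>.\<close>

lemma central_descents_closed:
  assumes z: "z \<in> center W" and edge: "(s, t) \<in> coxeter_graph W S"
    and "len (s \<otimes> z) < len z"
  shows "len (t \<otimes> z) < len z"
proof (rule ccontr)
  assume not_descent: "\<not> len (t \<otimes> z) < len z"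
  have st: "s \<in> S" "t \<in> S" using edge by (auto simp: coxeter_graph_def)
  have c: "z \<in> carrier W" "s \<in> carrier W" "t \<in> carrier W"
    and comm: "\<And>x. x \<in> carrier W \<Longrightarrow> x \<otimes> z = z \<otimes> x"
    using z st S_carrier by (auto simp: center_def)
  have up: "len (t \<otimes> z) = len z + 1"
    using len_S_mult[of t z] st c not_descent by auto
  have "s \<otimes> (t \<otimes> z) = (s \<otimes> z) \<otimes> t" using comm[of t] c by (simp add: m_assoc)
  then have "len (s \<otimes> (t \<otimes> z)) < len (t \<otimes> z)"
    using len_mult_le[of "s \<otimes> z" t] st c up assms(3) by (simp add: len_S)
  moreover have "len (t \<otimes> (t \<otimes> z)) < len (t \<otimes> z)"
    using up st c by (simp add: S_cancel)
  ultimately have "len (t \<otimes> (s \<otimes> (t \<otimes> (t \<otimes> z)))) + 3 \<le> len (t \<otimes> z)"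
    using braid_descents[of t s "t \<otimes> z"] coxeter_graph_not_commute[OF edge] st c by auto
  then have short: "len (t \<otimes> (s \<otimes> z)) + 2 \<le> len z"
    using st c up by (simp add: S_cancel)
  have "t \<otimes> (s \<otimes> z) = (t \<otimes> z) \<otimes> s"
    using comm[of s] c by (simp add: m_assoc)
  then show False
    using len_mult_S[of s "t \<otimes> z"] st c up short by auto
qed

lemma center_trivial:
  assumes "finite S" "infinite (carrier W)" "coxeter_irreducible W S"
  shows "center W \<subseteq> {\<one>}"
proof
  fix z assume z: "z \<in> center W"
  then have c: "z \<in> carrier W" by (simp add: center_def)
  show "z \<in> {\<one>}"
  proof (rule ccontr)
    assume "z \<notin> {\<one>}"
    obtain ss where ss: "set ss \<subseteq> S" "word_prod ss = z" "length ss = len z"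
      using reduced_word[OF c] by blast
    \<comment> \<open>The first letter of a reduced word is the descent from which connectedness of
      the graph reaches all generators.\<close>
    then obtain s us where us: "ss = s # us" using \<open>z \<notin> {\<one>}\<close> by (cases ss) auto
    have s: "s \<in> S" "set us \<subseteq> carrier W" using ss us S_carrier by auto
    have "s \<otimes> z = word_prod us" using ss us s S_cancel by auto
    then have desc: "len (s \<otimes> z) < len z" using len_le[of us] ss us by auto
    have "len (t \<otimes> z) < len z" if "(s, t) \<in> (coxeter_graph W S)\<^sup>*" for t
      using that
      by (induction rule: rtrancl_induct) (use desc central_descents_closed[OF z] in blast)+
    then have "len (t \<otimes> z) < len z" if "t \<in> S" for t
      using that s assms(3) by (auto simp: coxeter_irreducible_def)
    then show False using finite_if_longest assms c by blast
  qed
qed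

lemma one_in_center_alternating: "\<one> \<in> center (alternating_subgroup W S)"
  by (auto simp: center_def alternating_subgroup_def len_one)

end

theorem proposition1p5:
  fixes W :: "('a, 'b) monoid_scheme" and S :: "'a set"
  assumes "coxeter_system W S"
    and "finite S"
    and "card S \<ge> 3"
  shows "center (alternating_subgroup W S) \<subseteq> center W \<and>
    (infinite (carrier W) \<and> coxeter_irreducible W S \<longrightarrow>
       center (alternating_subgroup W S) = {\<one>\<^bsub>W\<^esub>})"
proof -
  interpret coxeter W S
    using assms(1) by (simp add: coxeter_def coxeter_axioms_def coxeter_system_def)
  show ?thesis
    using center_alternating_subset center_trivial one_in_center_alternating assms by blast
qed

end
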